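(* Let $\gamma:S^1\to\mathbb{R}^d$ be a topological embedding, let $\alpha:S^1\to S^1$ be a homeomorphism and let $\omega:\mathbb{R}^d\to\mathbb{R}^d$ be a Euclidean isometry. Then, in every homology degree, $$\mathrm{PH}(\mathcal{T}_{\omega\circ\gamma\circ\alpha})=\mathrm{PH}(\mathcal{T}_\gamma),\qquad \mathrm{PH}(\mathsf{T}_{\omega\circ\gamma\circ\alpha})=\mathrm{PH}(\mathsf{T}_\gamma).$$
   Context: $\mathbf{F}_2(S^1)$ is the set of non-empty subsets $\{z_1,z_2\}\subset S^1$ of cardinality at most $2$, with the quotient topology from $S^1\times S^1$. For continuous $\gamma:S^1\to\mathbb{R}^d$, the functions $\mathsf{T}_\gamma,\mathcal{T}_\gamma:\mathbf{F}_2(S^1)\to\mathbb{R}$ are $\mathsf{T}_\gamma(\{z_1,z_2\})=\|\gamma(z_1)-\gamma(z_2)\|_2$ and $\mathcal{T}_\gamma=\tfrac12\mathsf{T}_\gamma^2$. $\mathrm{PH}_i(f)$ denotes the persistence diagram of the ($q$-tame) persistence module $t\mapsto H_i(f^{-1}(-\infty,t])$ (coefficients in a fixed field, maps $v_s^t$ induced by inclusion, $r_s^t=\mathrm{rank}\,v_s^t$): the multiset of points $(b,d)$, $-\infty\le b<d\le\infty$, in which $(b,d)$ has multiplicity the minimum, over rectangles $[a,b']\times[c,d']$ with $a<b'<c<d'$ containing $(b,d)$ in the interior relative to the extended plane, of $r_{b'}^{c}-r_a^{c}-r_{b'}^{d'}+r_a^{d'}$ (vector spaces at $\pm\infty$ being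 $0$). *)

theory Defs
  imports "HOL-Analysis.Analysis" "HOL-Homology.Homology" "Jordan_Normal_Form.VS_Connect"
begin

section \<open>Singular homology with coefficients in a field\<close>

text \<open>
  The distribution's singular homology has integer coefficients. We keep its singular simplices,
  faces and maps of simplices, and replace the coefficient group by a field, which is an arbitrary
  type \<^typ>\<open>'k\<close> of class \<^class>\<open>field\<close>. Vector spaces are carrier-based, over \<^term>\<open>class_ring\<close>;
  the multiplicative components \<open>mult\<close> and \<open>one\<close> of the module records play no role.
\<close>

type_synonym ('a, 'k) kchain = "((nat \<Rightarrow> real) \<Rightarrow> 'a) \<Rightarrow>\<^sub>0 'k"

definition chain_space :: "nat \<Rightarrow> 'a topology \<Rightarrow> ('k::field, ('a, 'k) kchain) module" where
  "chain_space p X =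
     \<lparr>carrier = {c. Poly_Mapping.keys c \<subseteq> singular_simplex_set p X},
      mult = undefined, one = undefined, zero = 0, add = (+),
      smult = (\<lambda>a. Poly_Mapping.map ((*) a))\<rparr>"

definition kboundary :: "nat \<Rightarrow> ('a, 'k::field) kchain \<Rightarrow> ('a, 'k) kchain" where
  "kboundary p c =
     (if p = 0 then 0
      else \<Sum>\<sigma>\<in>Poly_Mapping.keys c. \<Sum>k\<le>p.
             Poly_Mapping.single (singular_face p k \<sigma>) ((-1) ^ k * Poly_Mapping.lookup c \<sigma>))"

definition kchain_map :: "nat \<Rightarrow> ('a \<Rightarrow> 'b) \<Rightarrow> ('a, 'k::field) kchain \<Rightarrow> ('b, 'k) kchain" where
  "kchain_map p g c =
     (\<Sum>\<sigma>\<in>Poly_Mapping.keys c. Poly_Mapping.single (simplex_map p g \<sigma>) (Poly_Mapping.lookup c \<sigma>))"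

definition cycle_space :: "nat \<Rightarrow> 'a topology \<Rightarrow> ('k::field, ('a, 'k) kchain) module" where
  "cycle_space p X =
     (chain_space p X)\<lparr>carrier := {c \<in> carrier (chain_space p X). kboundary p c = 0}\<rparr>"

definition boundaries :: "nat \<Rightarrow> 'a topology \<Rightarrow> ('a, 'k::field) kchain set" where
  "boundaries p X = kboundary (Suc p) ` carrier (chain_space (Suc p) X)"

definition quotient_space :: "('k, 'v, 'm) module_scheme \<Rightarrow> 'v set \<Rightarrow> ('k, 'v set) module" where
  "quotient_space V U =
     \<lparr>carrier = a_rcosets\<^bsub>V\<^esub> U,
      mult = undefined, one = undefined, zero = U, add = (\<lambda>A B. A <+>\<^bsub>V\<^esub> B),
      smult = (\<lambda>a A. \<Union>x\<in>A. U +>\<^bsub>V\<^esub> (a \<odot>\<^bsub>V\<^esub> x))\<rparr>"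

definition homology_space :: "nat \<Rightarrow> 'a topology \<Rightarrow> ('k::field, ('a, 'k) kchain set) module" where
  "homology_space p X = quotient_space (cycle_space p X) (boundaries p X)"

text \<open>
  The class of a cycle \<open>z\<close> is sent to the class of its image; all \<open>z\<close> in one class \<open>A\<close> give the
  same coset, so the union below is that coset.
\<close>

definition homology_map ::
  "nat \<Rightarrow> 'b topology \<Rightarrow> ('a \<Rightarrow> 'b) \<Rightarrow> ('a, 'k::field) kchain set \<Rightarrow> ('b, 'k) kchain set" where
  "homology_map p Y g A = (\<Union>z\<in>A. boundaries p Y +>\<^bsub>cycle_space p Y\<^esub> kchain_map p g z)"


section \<open>Persistence modules and persistence diagrams\<close>

text \<open>
  A persistence module over the reals consists of vector spaces \<open>V t\<close> and linear maps
  \<open>v s t\<close> from \<open>V s\<close> to \<open>V t\<close> for \<open>s \<le> t\<close>. The module is extended by the zero space at both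
  infinities, so every rank involving one of them is 0. In a q-tame module all ranks
  with \<open>s < t\<close> are finite, and no others are used below (\<^const>\<open>vectorspace.dim\<close> carries no
  information about infinite-dimensional spaces).
\<close>

definition pm_rank ::
  "(real \<Rightarrow> ('k::field, 'v) module) \<Rightarrow> (real \<Rightarrow> real \<Rightarrow> 'v \<Rightarrow> 'v) \<Rightarrow> ereal \<Rightarrow> ereal \<Rightarrow> nat" where
  "pm_rank V v s t =
     (case (s, t) of
        (ereal x, ereal y) \<Rightarrow>
          vectorspace.dim class_ring ((V y)\<lparr>carrier := v x y ` carrier (V x)\<rparr>)
      | _ \<Rightarrow> 0)"

definition rectangle_measure ::
  "(real \<Rightarrow> ('k::field, 'v) module) \<Rightarrow> (real \<Rightarrow> real \<Rightarrow> 'v \<Rightarrow> 'v)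
     \<Rightarrow> ereal \<Rightarrow> ereal \<Rightarrow> ereal \<Rightarrow> ereal \<Rightarrow> int" where
  "rectangle_measure V v a b' c d' =
     int (pm_rank V v b' c) - int (pm_rank V v a c)
     - int (pm_rank V v b' d') + int (pm_rank V v a d')"

text \<open>
  A multiset of points of the extended plane is represented by its multiplicity function. The
  minimum is taken over \<^typ>\<open>nat\<close> because the measure of a rectangle is never negative. The
  interior is the one in the product of extended real lines, so that \<open>a = b = -\<infinity>\<close> and
  \<open>d = d' = \<infinity>\<close> are allowed.
\<close>

definition persistence_diagram ::
  "(real \<Rightarrow> ('k::field, 'v) module) \<Rightarrow> (real \<Rightarrow> real \<Rightarrow> 'v \<Rightarrow> 'v) \<Rightarrow> ereal \<times> ereal \<Rightarrow> nat" where
  "persistence_diagram V v = (\<lambda>(b, d).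
     if b < d then
       (LEAST n. \<exists>a b' c d'. a < b' \<and> b' < c \<and> c < d' \<and>
          (b, d) \<in> interior ({a..b'} \<times> {c..d'}) \<and> int n = rectangle_measure V v a b' c d')
     else 0)"

definition sublevel :: "'a topology \<Rightarrow> ('a \<Rightarrow> real) \<Rightarrow> real \<Rightarrow> 'a topology" where
  "sublevel X f t = subtopology X {x \<in> topspace X. f x \<le> t}"

text \<open>The coefficient field is passed as a type argument, since the diagram's type does not mention it.\<close>

definition PH :: "'k::field itself \<Rightarrow> nat \<Rightarrow> 'a topology \<Rightarrow> ('a \<Rightarrow> real) \<Rightarrow> ereal \<times> ereal \<Rightarrow> nat" where
  "PH (_ :: 'k itself) i X f =
     persistence_diagram
       (\<lambda>t. homology_space i (sublevel X f t) :: ('k, ('a, 'k) kchain set) module)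
       (\<lambda>s t. homology_map i (sublevel X f t) id)"


section \<open>The space of subsets with at most two points\<close>

definition F2_carrier :: "'a topology \<Rightarrow> 'a set set" where
  "F2_carrier X = {A. A \<subseteq> topspace X \<and> A \<noteq> {} \<and> finite A \<and> card A \<le> 2}"

definition F2 :: "'a topology \<Rightarrow> 'a set topology" where
  "F2 X = topology (\<lambda>U. U \<subseteq> F2_carrier X \<and>
     openin (prod_topology X X) {p \<in> topspace (prod_topology X X). {fst p, snd p} \<in> U})"

lemma openin_F2:
  "openin (F2 X) U \<longleftrightarrow> U \<subseteq> F2_carrier X \<and>
     openin (prod_topology X X) {p \<in> topspace (prod_topology X X). {fst p, snd p} \<in> U}"
proof -
  let ?Q = "\<lambda>U. {p \<in> topspace (prod_topology X X). {fst p, snd p} \<in> U}"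
  have "istopology (\<lambda>U. U \<subseteq> F2_carrier X \<and> openin (prod_topology X X) (?Q U))"
    unfolding istopology_def
  proof (intro conjI allI impI)
    fix S T
    assume S: "S \<subseteq> F2_carrier X \<and> openin (prod_topology X X) (?Q S)"
      and T: "T \<subseteq> F2_carrier X \<and> openin (prod_topology X X) (?Q T)"
    have "?Q (S \<inter> T) = ?Q S \<inter> ?Q T" by auto
    with S T show "openin (prod_topology X X) (?Q (S \<inter> T))" by auto
    show "S \<inter> T \<subseteq> F2_carrier X" using S by auto
  next
    fix K
    assume K: "\<forall>U\<in>K. U \<subseteq> F2_carrier X \<and> openin (prod_topology X X) (?Q U)"
    have "?Q (\<Union>K) = \<Union>(?Q ` K)" by auto
    with K show "openin (prod_topology X X) (?Q (\<Union>K))" by auto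
    show "\<Union>K \<subseteq> F2_carrier X" using K by auto
  qed
  then show ?thesis by (simp add: F2_def)
qed

lemma quotient_map_F2: "quotient_map (prod_topology X X) (F2 X) (\<lambda>p. {fst p, snd p})"
proof -
  have img: "(\<lambda>p. {fst p, snd p}) ` topspace (prod_topology X X) = F2_carrier X"
  proof
    show "(\<lambda>p. {fst p, snd p}) ` topspace (prod_topology X X) \<subseteq> F2_carrier X"
      by (auto simp: F2_carrier_def card_insert_if)
    show "F2_carrier X \<subseteq> (\<lambda>p. {fst p, snd p}) ` topspace (prod_topology X X)"
    proof
      fix A assume A: "A \<in> F2_carrier X"
      then have "card A = 1 \<or> card A = 2"
        by (auto simp: F2_carrier_def le_Suc_eq numeral_2_eq_2)
      then obtain x y where "A = {x, y}"
        by (metis card_1_singletonE card_2_iff insert_absorb2)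
      with A show "A \<in> (\<lambda>p. {fst p, snd p}) ` topspace (prod_topology X X)"
        by (auto simp: F2_carrier_def intro!: image_eqI[of _ _ "(x, y)"])
    qed
  qed
  have "{p \<in> topspace (prod_topology X X). {fst p, snd p} \<in> F2_carrier X}
      = topspace (prod_topology X X)"
    using img by blast
  then have "openin (F2 X) (F2_carrier X)"
    by (simp add: openin_F2 flip: topspace_prod_topology)
  then have "topspace (F2 X) = F2_carrier X"
    by (meson openin_F2 openin_subset openin_topspace subset_antisym)
  then show ?thesis
    by (simp add: quotient_map_def img openin_F2 del: topspace_prod_topology)
qed

abbreviation circle :: "complex topology" where
  "circle \<equiv> top_of_set (sphere 0 1)"


section \<open>The distance functions of a curve\<close>

definition chord :: "('a \<Rightarrow> 'b::real_normed_vector) \<Rightarrow> 'a set \<Rightarrow> real" where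
  "chord \<gamma> A = (THE r. \<exists>z\<^sub>1 z\<^sub>2. A = {z\<^sub>1, z\<^sub>2} \<and> r = norm (\<gamma> z\<^sub>1 - \<gamma> z\<^sub>2))"

lemma chord_insert: "chord \<gamma> {z\<^sub>1, z\<^sub>2} = norm (\<gamma> z\<^sub>1 - \<gamma> z\<^sub>2)"
  unfolding chord_def
  by (rule the_equality) (auto simp: doubleton_eq_iff norm_minus_commute)

definition half_sq_chord :: "('a \<Rightarrow> 'b::real_normed_vector) \<Rightarrow> 'a set \<Rightarrow> real" where
  "half_sq_chord \<gamma> A = (chord \<gamma> A)\<^sup>2 / 2"

end

theory Submission
  imports Defs
begin

text \<open>
  The homeomorphism \<open>\<alpha>\<close> induces a homeomorphism \<open>A \<mapsto> \<alpha> ` A\<close> of the space of subsets with at most two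
  points, and since \<open>\<omega>\<close> preserves distances it pulls the chord function of \<open>\<gamma>\<close> back to that of
  \<open>\<omega> \<circ> \<gamma> \<circ> \<alpha>\<close>. It therefore restricts to compatible homeomorphisms of all sublevel sets. The rank of an
  inclusion of sublevel sets is the dimension of the cycles of the smaller set modulo the
  boundaries of the larger one; the chain map of the homeomorphism carries cycles onto cycles and
  boundaries onto boundaries, hence preserves these dimensions and with them the diagram.
\<close>

section \<open>Dimension under linear isomorphisms\<close>

text \<open>Coefficients are reindexed along \<open>T\<close>, from a finite subset of
  \<open>A\<close> to its image and back; on that subset \<open>T\<close> is injective.\<close>

lemma (in linear_map) span_image:
  assumes inj: "inj_on T (carrier V)" and A: "A \<subseteq> carrier V"
  shows "W.module.span (T ` A) = T ` V.module.span A"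
proof
  show "W.module.span (T ` A) \<subseteq> T ` V.module.span A"
  proof
    fix w assume "w \<in> W.module.span (T ` A)"
    then obtain a C where w: "w = W.module.lincomb a C" "finite C" "C \<subseteq> T ` A" "a \<in> C \<rightarrow> carrier K"
      unfolding W.module.span_def by blast
    then obtain D where D: "D \<subseteq> A" "finite D" "C = T ` D"
      using finite_subset_image by metis
    have "w = T (V.module.lincomb (a \<circ> T) D)"
      using lincomb_linear_image[OF inj, of D a] w D A by auto
    moreover have "V.module.lincomb (a \<circ> T) D \<in> V.module.span A"
      unfolding V.module.span_def using D w by (intro CollectI exI[of _ "a \<circ> T"] exI[of _ D]) auto
    ultimately show "w \<in> T ` V.module.span A" by blast
  qed
  show "T ` V.module.span A \<subseteq> W.module.span (T ` A)"
  proof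
    fix w assume "w \<in> T ` V.module.span A"
    then obtain a D where w: "w = T (V.module.lincomb a D)"
      and D: "finite D" "D \<subseteq> A" "a \<in> D \<rightarrow> carrier K"
      unfolding V.module.span_def by blast
    let ?b = "a \<circ> inv_into D T"
    have injD: "inj_on T D" using inj D A by (meson inj_on_subset)
    have b: "?b \<in> T ` D \<rightarrow> carrier K"
      using D injD by auto
    have "V.module.lincomb (?b \<circ> T) D = V.module.lincomb a D"
      using D A injD by (intro V.module.lincomb_cong) auto
    then have "w = W.module.lincomb ?b (T ` D)"
      using lincomb_linear_image[OF inj _ b] w D A by auto
    then show "w \<in> W.module.span (T ` A)"
      using b D unfolding W.module.span_def by blast
  qed
qed

text \<open>\<open>dim\<close> is the least size of a finite generating set, and \<open>T\<close>
  matches generating sets of the two spaces without changing their size. Both sides are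
  \<open>LEAST\<close> of one predicate, so the equation also covers infinite dimension, where no
  number satisfies it.\<close>

lemma (in linear_map) dim_eq_of_bij:
  assumes bij: "bij_betw T (carrier V) (carrier W)"
  shows "vectorspace.dim K V = vectorspace.dim K W"
proof -
  have inj: "inj_on T (carrier V)" and im: "T ` carrier V = carrier W"
    using bij by (auto simp: bij_betw_def)
  have *: "V.module.span A = carrier V \<longleftrightarrow> W.module.span (T ` A) = carrier W" if "A \<subseteq> carrier V" for A
  proof -
    have "V.module.span A \<subseteq> carrier V" by (rule V.module.span_is_subset2) (rule that)
    then have "T ` V.module.span A = T ` carrier V \<longleftrightarrow> V.module.span A = carrier V"
      using inj by (simp add: inj_on_image_eq_iff)
    then show ?thesis by (simp add: span_image[OF inj that] im)
  qed
  have card: "card (T ` A) = card A" if "A \<subseteq> carrier V" for A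
    using inj that by (meson card_image inj_on_subset)
  have "(\<exists>A. finite A \<and> card A = n \<and> A \<subseteq> carrier V \<and> V.module.span A = carrier V)
      \<longleftrightarrow> (\<exists>A. finite A \<and> card A = n \<and> A \<subseteq> carrier W \<and> W.module.span A = carrier W)"
    (is "?L \<longleftrightarrow> ?R") for n
  proof
    assume ?L
    then obtain A where "finite A" "card A = n" "A \<subseteq> carrier V" "V.module.span A = carrier V" by blast
    then show ?R using * card im by (intro exI[of _ "T ` A"]) auto
  next
    assume ?R
    then obtain A where A: "finite A" "card A = n" "A \<subseteq> carrier W" "W.module.span A = carrier W" by blast
    \<comment> \<open>A generating set of \<open>W\<close> is pulled back along a section of
      \<open>T\<close>; its image under \<open>T\<close> is the given set, so it has the same size
      and generates \<open>V\<close>.\<close>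
    let ?A = "inv_into (carrier V) T ` A"
    have "T ` ?A = A" using A(3) im by (simp add: image_inv_into_cancel)
    moreover have "?A \<subseteq> carrier V" using A(3) im by (metis image_subsetI inv_into_into subsetD)
    ultimately show ?L using A * card by (intro exI[of _ ?A]) (metis finite_imageI)
  qed
  then show ?thesis by (simp add: V.dim_def W.dim_def)
qed


section \<open>Chains\<close>

abbreviation kscale :: "'k::field \<Rightarrow> ('a, 'k) kchain \<Rightarrow> ('a, 'k) kchain" where
  "kscale a \<equiv> Poly_Mapping.map ((*) a)"

text \<open>\<open>Poly_Mapping.map\<close> leaves vanishing coefficients at \<open>0\<close>, in
  accordance with \<open>a * 0 = 0\<close>. This formula reduces the module laws to the field,
  coefficient by coefficient.\<close>

lemma lookup_kscale: "Poly_Mapping.lookup (kscale a c) \<sigma> = a * Poly_Mapping.lookup c \<sigma>"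
  by (simp add: Poly_Mapping.map.rep_eq when_def)

lemma keys_kscale: "Poly_Mapping.keys (kscale a c) \<subseteq> Poly_Mapping.keys c"
  by (auto simp: in_keys_iff lookup_kscale)

lemma kscale_add: "kscale a (x + y) = kscale a x + kscale a y"
  by (rule poly_mapping_eqI) (simp add: lookup_kscale lookup_add distrib_left)

lemma kscale_add_left: "kscale (a + b) x = kscale a x + kscale b x"
  by (rule poly_mapping_eqI) (simp add: lookup_kscale lookup_add distrib_right)

lemma kscale_kscale: "kscale a (kscale b x) = kscale (a * b) x"
  by (rule poly_mapping_eqI) (simp add: lookup_kscale mult.assoc)

lemma kscale_one: "kscale 1 x = x"
  by (rule poly_mapping_eqI) (simp add: lookup_kscale)

lemma kscale_zero: "kscale a 0 = 0"
  by (rule poly_mapping_eqI) (simp add: lookup_kscale)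

lemma kscale_minus_one: "kscale (-1) x = - x"
  by (rule poly_mapping_eqI) (simp add: lookup_kscale)

lemma kscale_single: "kscale a (Poly_Mapping.single \<sigma> b) = Poly_Mapping.single \<sigma> (a * b)"
  by (rule poly_mapping_eqI) (simp add: lookup_kscale lookup_single when_def)

lemma kscale_sum: "kscale a (sum f A) = (\<Sum>x\<in>A. kscale a (f x))"
  by (induction A rule: infinite_finite_induct) (simp_all add: kscale_add kscale_zero)

text \<open>Expands a chain in its simplices, so that linear maps can be compared on single
  simplices.\<close>

lemma kchain_eq_sum_single:
  "(\<Sum>\<sigma>\<in>Poly_Mapping.keys c. Poly_Mapping.single \<sigma> (Poly_Mapping.lookup c \<sigma>)) = (c :: ('a, 'k::field) kchain)"
  by (rule poly_mapping_eqI)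
    (simp add: lookup_sum lookup_single when_def in_keys_iff sum.delta)

text \<open>Linearity refers to all formal sums, because \<open>kboundary\<close> and
  \<open>kchain_map\<close> are total functions that do not mention a space.\<close>

definition klinear :: "(('a, 'k::field) kchain \<Rightarrow> ('b, 'k) kchain) \<Rightarrow> bool" where
  "klinear F \<longleftrightarrow> (\<forall>x y. F (x + y) = F x + F y) \<and> (\<forall>a x. F (kscale a x) = kscale a (F x))"

lemma klinear_add: "klinear F \<Longrightarrow> F (x + y) = F x + F y"
  by (simp add: klinear_def)

lemma klinear_kscale: "klinear F \<Longrightarrow> F (kscale a x) = kscale a (F x)"
  by (simp add: klinear_def)

lemma klinear_zero: "klinear F \<Longrightarrow> F 0 = 0"
  using klinear_add[of F 0 0] by simp

lemma klinear_sum: "klinear F \<Longrightarrow> F (sum f A) = (\<Sum>x\<in>A. F (f x))"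
  by (induction A rule: infinite_finite_induct) (simp_all add: klinear_add klinear_zero)

text \<open>The support over which the sum runs varies with \<open>c\<close>. Additivity forces
  \<open>f \<sigma> 0 = 0\<close>, so summands outside the support may be added freely.\<close>

lemma klinear_extend:
  assumes add: "\<And>\<sigma> a b. f \<sigma> (a + b) = f \<sigma> a + f \<sigma> b"
    and scale: "\<And>\<sigma> a b. f \<sigma> (a * b) = kscale a (f \<sigma> b)"
  shows "klinear (\<lambda>c. \<Sum>\<sigma>\<in>Poly_Mapping.keys c. f \<sigma> (Poly_Mapping.lookup c \<sigma>))"
proof -
  have zero: "f \<sigma> 0 = 0" for \<sigma> using add[of \<sigma> 0 0] by simp
  have "(\<Sum>\<sigma>\<in>Poly_Mapping.keys (kscale a c). f \<sigma> (Poly_Mapping.lookup (kscale a c) \<sigma>))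
      = kscale a (\<Sum>\<sigma>\<in>Poly_Mapping.keys c. f \<sigma> (Poly_Mapping.lookup c \<sigma>))" for a c
  proof -
    have "(\<Sum>\<sigma>\<in>Poly_Mapping.keys (kscale a c). f \<sigma> (Poly_Mapping.lookup (kscale a c) \<sigma>))
        = (\<Sum>\<sigma>\<in>Poly_Mapping.keys c. f \<sigma> (Poly_Mapping.lookup (kscale a c) \<sigma>))"
      by (rule sum.mono_neutral_left) (auto simp: keys_kscale in_keys_iff zero)
    then show ?thesis by (simp add: lookup_kscale scale kscale_sum)
  qed
  then show ?thesis
    by (simp add: klinear_def setsum_keys_plus_distrib[of f] zero add)
qed

section \<open>Boundary operator and chain maps\<close>

lemma klinear_kchain_map: "klinear (kchain_map p g)"
  unfolding kchain_map_def[abs_def]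
  by (rule klinear_extend) (simp_all add: single_add kscale_single)

lemma klinear_kboundary: "klinear (kboundary p)"
proof (cases "p = 0")
  case True
  then show ?thesis by (simp add: klinear_def kboundary_def kscale_zero)
next
  case False
  have "klinear (\<lambda>c. \<Sum>\<sigma>\<in>Poly_Mapping.keys c. \<Sum>k\<le>p.
             Poly_Mapping.single (singular_face p k \<sigma>) ((-1) ^ k * Poly_Mapping.lookup c \<sigma>))"
    by (rule klinear_extend)
      (simp_all add: distrib_left single_add sum.distrib kscale_sum kscale_single mult.left_commute)
  then show ?thesis using False by (simp add: kboundary_def[abs_def])
qed

lemma kchain_map_single:
  "kchain_map p g (Poly_Mapping.single \<sigma> a) = Poly_Mapping.single (simplex_map p g \<sigma>) a"
  by (cases "a = 0") (simp_all add: kchain_map_def)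

lemma kboundary_single:
  "kboundary p (Poly_Mapping.single \<sigma> a) =
     (if p = 0 then 0 else \<Sum>k\<le>p. Poly_Mapping.single (singular_face p k \<sigma>) ((-1) ^ k * a))"
  by (cases "a = 0") (simp_all add: kboundary_def)

text \<open>By linearity it suffices to treat one simplex, and there restricting to a face commutes
  with composing with \<open>g\<close>. In degree \<open>0\<close> both sides vanish.\<close>

lemma kboundary_kchain_map:
  "kboundary p (kchain_map p g c) = kchain_map (p - Suc 0) g (kboundary p c)"
proof (cases "p = 0")
  case True
  then show ?thesis by (simp add: kboundary_def kchain_map_def)
next
  case False
  \<comment> \<open>The bound on \<open>k\<close> keeps the face of a point inside the standard
    \<open>p\<close>-simplex, the set to which \<open>simplex_map\<close> restricts its
    value.\<close>
  have face: "singular_face p k (simplex_map p g \<sigma>) = simplex_map (p - Suc 0) g (singular_face p k \<sigma>)"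
    if "k \<le> p" for k \<sigma>
    using that False
    by (fastforce simp: singular_face_def simplex_map_def simplical_face_in_standard_simplex)
  let ?s = "\<lambda>\<sigma>. Poly_Mapping.single \<sigma> (Poly_Mapping.lookup c \<sigma>)"
  have "kboundary p (kchain_map p g (?s \<sigma>)) = kchain_map (p - Suc 0) g (kboundary p (?s \<sigma>))" for \<sigma>
    using False
    by (simp add: kchain_map_single kboundary_single klinear_sum[OF klinear_kchain_map] face)
  then have "kboundary p (kchain_map p g (\<Sum>\<sigma>\<in>Poly_Mapping.keys c. ?s \<sigma>))
      = kchain_map (p - Suc 0) g (kboundary p (\<Sum>\<sigma>\<in>Poly_Mapping.keys c. ?s \<sigma>))"
    by (simp add: klinear_sum[OF klinear_kchain_map] klinear_sum[OF klinear_kboundary])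
  then show ?thesis by (simp add: kchain_eq_sum_single)
qed

section \<open>Subspaces of chains, cycles and boundaries\<close>

definition ksubspace :: "('a, 'k::field) kchain set \<Rightarrow> bool" where
  "ksubspace S \<longleftrightarrow> 0 \<in> S \<and> (\<forall>x\<in>S. \<forall>y\<in>S. x + y \<in> S) \<and> (\<forall>a. \<forall>x\<in>S. kscale a x \<in> S)"

lemma ksubspaceD:
  assumes "ksubspace S"
  shows "0 \<in> S" "\<And>x y. x \<in> S \<Longrightarrow> y \<in> S \<Longrightarrow> x + y \<in> S" "\<And>a x. x \<in> S \<Longrightarrow> kscale a x \<in> S"
    "\<And>x. x \<in> S \<Longrightarrow> - x \<in> S"
  using assms unfolding ksubspace_def by (auto simp flip: kscale_minus_one)

lemma ksubspace_sum: "ksubspace S \<Longrightarrow> (\<And>x. x \<in> A \<Longrightarrow> f x \<in> S) \<Longrightarrow> sum f A \<in> S"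
  by (induction A rule: infinite_finite_induct) (auto simp: ksubspaceD)

lemma ksubspace_image:
  assumes "ksubspace S" "klinear F"
  shows "ksubspace (F ` S)"
  unfolding ksubspace_def
proof (intro conjI ballI allI)
  show "0 \<in> F ` S" using assms by (metis ksubspaceD(1) klinear_zero imageI)
  show "x + y \<in> F ` S" if "x \<in> F ` S" "y \<in> F ` S" for x y
    using that assms by (auto simp: klinear_add[symmetric] ksubspaceD)
  show "kscale a x \<in> F ` S" if "x \<in> F ` S" for a x
    using that assms by (auto simp: klinear_kscale[symmetric] ksubspaceD)
qed

lemma carrier_chain_space: "carrier (chain_space p X) = {c. Poly_Mapping.keys c \<subseteq> singular_simplex_set p X}"
  by (simp add: chain_space_def)

lemma carrier_cycle_space:
  "carrier (cycle_space p X) = {c \<in> carrier (chain_space p X). kboundary p c = 0}"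
  by (simp add: cycle_space_def)

lemma ksubspace_chains: "ksubspace (carrier (chain_space p X))"
  unfolding ksubspace_def carrier_chain_space
  using keys_kscale Poly_Mapping.keys_add by fastforce

lemma ksubspace_cycles: "ksubspace (carrier (cycle_space p X))"
  unfolding ksubspace_def carrier_cycle_space
  by (auto simp: ksubspaceD[OF ksubspace_chains] kscale_zero klinear_zero[OF klinear_kboundary]
      klinear_add[OF klinear_kboundary] klinear_kscale[OF klinear_kboundary])

lemma ksubspace_boundaries: "ksubspace (boundaries p X)"
  unfolding boundaries_def by (intro ksubspace_image ksubspace_chains klinear_kboundary)

lemma single_in_chains: "singular_simplex p X \<sigma> \<Longrightarrow> Poly_Mapping.single \<sigma> a \<in> carrier (chain_space p X)"
  by (simp add: carrier_chain_space)

lemma kchain_map_in_chains: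
  assumes "c \<in> carrier (chain_space p X)" "continuous_map X Y g"
  shows "kchain_map p g c \<in> carrier (chain_space p Y)"
  unfolding kchain_map_def using assms
  by (intro ksubspace_sum ksubspace_chains single_in_chains singular_simplex_simplex_map)
    (auto simp: carrier_chain_space)

text \<open>Faces of singular simplices are singular simplices. Cosets of chains modulo boundaries
  therefore stay within the chains of \<open>X\<close>, where chain maps of homeomorphisms are
  injective.\<close>

lemma boundaries_subset_chains: "boundaries p X \<subseteq> carrier (chain_space p X)"
proof -
  have face: "singular_simplex p X (singular_face (Suc p) k \<sigma>)"
    if "singular_simplex (Suc p) X \<sigma>" "k \<le> Suc p" for k \<sigma>
    using singular_simplex_singular_face[of "Suc p" X \<sigma> k] that by simp
  have "kboundary (Suc p) c \<in> carrier (chain_space p X)" if "c \<in> carrier (chain_space (Suc p) X)" for c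
    unfolding kboundary_def if_not_P[OF Suc_not_Zero]
    by (intro ksubspace_sum ksubspace_chains single_in_chains face)
      (use that in \<open>auto simp: carrier_chain_space\<close>)
  then show ?thesis unfolding boundaries_def by auto
qed

text \<open>A simplex of \<open>X\<close> has its values in \<open>topspace X\<close>, where
  \<open>k\<close> undoes \<open>h\<close>. With \<open>h\<close> and \<open>k\<close> exchanged
  this also yields surjectivity of the chain map of a homeomorphism.\<close>

lemma kchain_map_inverse:
  assumes c: "c \<in> carrier (chain_space p X)" and inv: "\<And>x. x \<in> topspace X \<Longrightarrow> k (h x) = x"
  shows "kchain_map p k (kchain_map p h c) = c"
proof -
  have "simplex_map p k (simplex_map p h \<sigma>) = \<sigma>" if "\<sigma> \<in> Poly_Mapping.keys c" for \<sigma>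
    using simplex_map_id_gen[of p X \<sigma> "k \<circ> h"] that c inv
    by (auto simp: carrier_chain_space simplex_map_compose)
  then have "kchain_map p k (kchain_map p h c)
      = (\<Sum>\<sigma>\<in>Poly_Mapping.keys c. Poly_Mapping.single \<sigma> (Poly_Mapping.lookup c \<sigma>))"
    unfolding kchain_map_def[of p h]
    by (simp add: klinear_sum[OF klinear_kchain_map] kchain_map_single)
  then show ?thesis by (simp add: kchain_eq_sum_single)
qed

text \<open>Singular simplices are extensional functions, so the restriction inside
  \<open>simplex_map\<close> does not alter them.\<close>

lemma kchain_map_id: "c \<in> carrier (chain_space p X) \<Longrightarrow> kchain_map p id c = c"
proof -
  assume c: "c \<in> carrier (chain_space p X)"
  then have "simplex_map p id \<sigma> = \<sigma>" if "\<sigma> \<in> Poly_Mapping.keys c" for \<sigma>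
    using simplex_map_id_gen[of p X \<sigma> id] that by (auto simp: carrier_chain_space)
  then show ?thesis unfolding kchain_map_def by (simp add: kchain_eq_sum_single)
qed


section \<open>Quotients of chain spaces\<close>

text \<open>The coset \<open>B +> z\<close> in the additive group of all formal sums, with no module
  record and the summands in the order of \<open>a_r_coset\<close>.\<close>

definition kcoset :: "('a, 'k::field) kchain set \<Rightarrow> ('a, 'k) kchain \<Rightarrow> ('a, 'k) kchain set" where
  "kcoset B z = (\<lambda>b. b + z) ` B"

text \<open>The union is the set sum \<open><+>\<close> of two cosets. One inclusion uses closure of
  \<open>B\<close> under addition, the other puts all of \<open>b\<close> into the first summand and
  \<open>0\<close> into the second.\<close>

lemma kcoset_add:
  assumes "ksubspace B"
  shows "(\<Union>x\<in>kcoset B z. \<Union>y\<in>kcoset B w. {x + y}) = kcoset B (z + w)"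
proof
  show "(\<Union>x\<in>kcoset B z. \<Union>y\<in>kcoset B w. {x + y}) \<subseteq> kcoset B (z + w)"
  proof clarsimp
    fix x y assume "x \<in> kcoset B z" "y \<in> kcoset B w"
    then obtain b b' where "b \<in> B" "b' \<in> B" "x = b + z" "y = b' + w" by (auto simp: kcoset_def)
    then have "x + y = (b + b') + (z + w)" "b + b' \<in> B"
      using assms by (auto simp: ksubspaceD algebra_simps)
    then show "x + y \<in> kcoset B (z + w)" by (auto simp: kcoset_def)
  qed
  show "kcoset B (z + w) \<subseteq> (\<Union>x\<in>kcoset B z. \<Union>y\<in>kcoset B w. {x + y})"
  proof
    fix u assume "u \<in> kcoset B (z + w)"
    then obtain b where "b \<in> B" "u = (b + z) + (0 + w)" by (auto simp: kcoset_def algebra_simps)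
    then show "u \<in> (\<Union>x\<in>kcoset B z. \<Union>y\<in>kcoset B w. {x + y})"
      using ksubspaceD(1)[OF assms] unfolding kcoset_def by blast
  qed
qed

text \<open>Independence of the representative: for \<open>x = b + z\<close> the values
  \<open>F x\<close> and \<open>F z\<close> differ by \<open>F b\<close>, which lies in
  \<open>B'\<close>. It serves scalar multiplication with \<open>F = kscale a\<close> and inclusions
  with \<open>F\<close> the identity.\<close>

lemma kcoset_UN:
  assumes B: "ksubspace B" "ksubspace B'" and F: "klinear F" "F ` B \<subseteq> B'"
  shows "(\<Union>x\<in>kcoset B z. kcoset B' (F x)) = kcoset B' (F z)"
proof
  show "(\<Union>x\<in>kcoset B z. kcoset B' (F x)) \<subseteq> kcoset B' (F z)"
  proof clarsimp
    fix x u assume "x \<in> kcoset B z" "u \<in> kcoset B' (F x)"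
    then obtain b b' where "b \<in> B" "x = b + z" "b' \<in> B'" "u = b' + F x" by (auto simp: kcoset_def)
    then have "u = (b' + F b) + F z" "b' + F b \<in> B'"
      using B F by (auto simp: ksubspaceD klinear_add add.assoc)
    then show "u \<in> kcoset B' (F z)" by (auto simp: kcoset_def)
  qed
  show "kcoset B' (F z) \<subseteq> (\<Union>x\<in>kcoset B z. kcoset B' (F x))"
    using ksubspaceD(1)[OF B(1)] unfolding kcoset_def by (force intro: bexI[of _ "0 + z"])
qed

lemma klinear_kscale_self: "klinear (kscale a)"
  by (simp add: klinear_def kscale_add kscale_kscale mult.commute)

text \<open>
  \<open>B \<subseteq> Z\<close> is not required: the carrier consists of cosets in the space of all chains. Hence the
  identity \<open>\<partial>\<partial> = 0\<close> plays no role.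
\<close>

abbreviation kquotient ::
  "('a, 'k::field) kchain set \<Rightarrow> ('a, 'k) kchain set \<Rightarrow> ('k, ('a, 'k) kchain set) module" where
  "kquotient B Z \<equiv>
     \<lparr>carrier = kcoset B ` Z, mult = undefined, one = undefined, zero = B,
      add = (\<lambda>C D. \<Union>x\<in>C. \<Union>y\<in>D. {x + y}),
      smult = (\<lambda>a C. \<Union>x\<in>C. kcoset B (kscale a x))\<rparr>"

text \<open>Once cosets and set sums are unfolded the two records agree in every component, so the
  rest can be argued with \<open>kcoset\<close>.\<close>

lemma homology_space_eq: "homology_space p X = kquotient (boundaries p X) (carrier (cycle_space p X))"
  by (auto simp: homology_space_def quotient_space_def A_RCOSETS_defs a_r_coset_defs set_add_defs
      cycle_space_def chain_space_def kcoset_def fun_eq_iff)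

lemma kcoset_zero: "kcoset B 0 = B"
  by (simp add: kcoset_def)

lemma kcoset_smult:
  assumes "ksubspace B"
  shows "(\<Union>x\<in>kcoset B z. kcoset B (kscale a x)) = kcoset B (kscale a z)"
  using assms by (intro kcoset_UN klinear_kscale_self) (auto simp: ksubspaceD)

text \<open>The operations act on representatives by \<open>kcoset_add\<close> and
  \<open>kcoset_smult\<close>, so each axiom comes from the same law for chains. The zero
  \<open>B\<close> is read as \<open>kcoset B 0\<close>.\<close>

lemma vectorspace_kquotient:
  fixes B Z :: "('a, 'k::field) kchain set"
  assumes B: "ksubspace B" and Z: "ksubspace Z"
  shows "vectorspace class_ring (kquotient B Z)"
proof (rule vs_criteria)
  note [simp] = kcoset_add[OF B] kcoset_smult[OF B]
  let ?Q = "kquotient B Z"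
  show "field (class_ring :: 'k ring)" by (rule class_field)
  show "\<zero>\<^bsub>?Q\<^esub> \<in> carrier ?Q"
    using ksubspaceD(1)[OF Z] kcoset_zero[of B] by (auto intro: rev_image_eqI)
  show "\<forall>v w. v \<in> carrier ?Q \<and> w \<in> carrier ?Q \<longrightarrow> v \<oplus>\<^bsub>?Q\<^esub> w \<in> carrier ?Q"
    using ksubspaceD(2)[OF Z] by auto
  show "\<forall>v\<in>carrier ?Q. \<exists>neg_v\<in>carrier ?Q. v \<oplus>\<^bsub>?Q\<^esub> neg_v = \<zero>\<^bsub>?Q\<^esub>"
  proof
    fix v assume "v \<in> carrier ?Q"
    then obtain z where "z \<in> Z" "v = kcoset B z" by auto
    then show "\<exists>neg_v\<in>carrier ?Q. v \<oplus>\<^bsub>?Q\<^esub> neg_v = \<zero>\<^bsub>?Q\<^esub>"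
      using ksubspaceD(4)[OF Z] by (intro bexI[of _ "kcoset B (- z)"]) (auto simp: kcoset_zero)
  qed
  show "\<forall>c v. c \<in> carrier class_ring \<and> v \<in> carrier ?Q \<longrightarrow> c \<odot>\<^bsub>?Q\<^esub> v \<in> carrier ?Q"
    using ksubspaceD(3)[OF Z] by auto
  show "\<forall>v w. v \<in> carrier ?Q \<and> w \<in> carrier ?Q \<longrightarrow> v \<oplus>\<^bsub>?Q\<^esub> w = w \<oplus>\<^bsub>?Q\<^esub> v"
    by (clarsimp simp: add.commute)
  show "\<forall>v w x. v \<in> carrier ?Q \<and> w \<in> carrier ?Q \<and> x \<in> carrier ?Q \<longrightarrow>
      v \<oplus>\<^bsub>?Q\<^esub> w \<oplus>\<^bsub>?Q\<^esub> x = v \<oplus>\<^bsub>?Q\<^esub> (w \<oplus>\<^bsub>?Q\<^esub> x)"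
    by (clarsimp simp: add.assoc)
  show "\<forall>v\<in>carrier ?Q. v \<oplus>\<^bsub>?Q\<^esub> \<zero>\<^bsub>?Q\<^esub> = v"
    using kcoset_add[OF B, where w = 0] by (simp add: kcoset_zero)
  show "\<forall>a b v. a \<in> carrier class_ring \<and> b \<in> carrier class_ring \<and> v \<in> carrier ?Q \<longrightarrow>
      (a \<otimes>\<^bsub>class_ring\<^esub> b) \<odot>\<^bsub>?Q\<^esub> v = a \<odot>\<^bsub>?Q\<^esub> (b \<odot>\<^bsub>?Q\<^esub> v)"
    by (clarsimp simp: kscale_kscale class_ring_simps)
  show "\<forall>v\<in>carrier ?Q. \<one>\<^bsub>class_ring\<^esub> \<odot>\<^bsub>?Q\<^esub> v = v"
    using kcoset_smult[OF B, where a = 1] by (clarsimp simp: kscale_one class_ring_simps)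
  show "\<forall>a b v. a \<in> carrier class_ring \<and> b \<in> carrier class_ring \<and> v \<in> carrier ?Q \<longrightarrow>
      (a \<oplus>\<^bsub>class_ring\<^esub> b) \<odot>\<^bsub>?Q\<^esub> v = a \<odot>\<^bsub>?Q\<^esub> v \<oplus>\<^bsub>?Q\<^esub> b \<odot>\<^bsub>?Q\<^esub> v"
    by (clarsimp simp: class_ring_simps simp flip: kscale_add_left
        simp del: UN_simps UN_UN_flatten)
  show "\<forall>a v w. a \<in> carrier class_ring \<and> v \<in> carrier ?Q \<and> w \<in> carrier ?Q \<longrightarrow>
      a \<odot>\<^bsub>?Q\<^esub> (v \<oplus>\<^bsub>?Q\<^esub> w) = a \<odot>\<^bsub>?Q\<^esub> v \<oplus>\<^bsub>?Q\<^esub> a \<odot>\<^bsub>?Q\<^esub> w"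
    by (clarsimp simp: class_ring_simps simp flip: kscale_add
        simp del: UN_simps UN_UN_flatten)
qed

lemma image_kcoset: "klinear F \<Longrightarrow> F ` kcoset B z = kcoset (F ` B) (F z)"
  by (simp add: kcoset_def image_image klinear_add)

text \<open>\<open>image F\<close> maps the coset of \<open>z\<close> to the coset of
  \<open>F z\<close> and is a linear bijection of the quotients.\<close>

lemma dim_kquotient_image:
  assumes F: "klinear F" "inj_on F C"
    and B: "ksubspace B" "B \<subseteq> C" and Z: "ksubspace Z" "Z \<subseteq> C" and C: "ksubspace C"
  shows "vectorspace.dim class_ring (kquotient B Z)
       = vectorspace.dim class_ring (kquotient (F ` B) (F ` Z))"
proof -
  let ?V = "kquotient B Z" and ?W = "kquotient (F ` B) (F ` Z)"
  note sub = ksubspace_image[OF B(1) F(1)] ksubspace_image[OF Z(1) F(1)]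
  have add: "F ` (\<Union>x\<in>kcoset B z. \<Union>y\<in>kcoset B w. {x + y})
      = (\<Union>x\<in>F ` kcoset B z. \<Union>y\<in>F ` kcoset B w. {x + y})" for z w
    by (simp only: image_kcoset[OF F(1)] kcoset_add[OF B(1)] kcoset_add[OF sub(1)] klinear_add[OF F(1)])
  have smult: "F ` (\<Union>x\<in>kcoset B z. kcoset B (kscale a x))
      = (\<Union>x\<in>F ` kcoset B z. kcoset (F ` B) (kscale a x))" for a z
    by (simp only: image_kcoset[OF F(1)] kcoset_smult[OF B(1)] kcoset_smult[OF sub(1)]
        klinear_kscale[OF F(1)])
  have "image F \<in> module_hom class_ring ?V ?W"
    unfolding module_hom_def
  proof (intro CollectI conjI allI impI)
    show "image F \<in> carrier ?V \<rightarrow> carrier ?W"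
      by (auto simp: image_kcoset[OF F(1)])
    show "F ` (m \<oplus>\<^bsub>?V\<^esub> n) = F ` m \<oplus>\<^bsub>?W\<^esub> F ` n" if mn: "m \<in> carrier ?V \<and> n \<in> carrier ?V" for m n
    proof -
      obtain z w where "m = kcoset B z" "n = kcoset B w" using mn by auto
      with add[where z = z and w = w] show ?thesis by simp
    qed
    show "F ` (a \<odot>\<^bsub>?V\<^esub> m) = a \<odot>\<^bsub>?W\<^esub> F ` m" if am: "a \<in> carrier class_ring \<and> m \<in> carrier ?V" for a m
    proof -
      obtain z where "m = kcoset B z" using am by auto
      with smult[where z = z and a = a] show ?thesis by simp
    qed
  qed
  then have lin: "linear_map class_ring ?V ?W (image F)"
    using vectorspace_kquotient[OF B(1) Z(1)] vectorspace_kquotient[OF sub]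
    by (simp add: linear_map_def mod_hom_def mod_hom_axioms_def vectorspace_def)
  \<comment> \<open>All cosets lie in \<open>C\<close>, and on subsets of \<open>C\<close> taking
    images under \<open>F\<close> is injective.\<close>
  have "kcoset B z \<subseteq> C" if "z \<in> Z" for z
    using that B(2) Z(2) ksubspaceD(2)[OF C] by (auto simp: kcoset_def)
  then have "inj_on (image F) (kcoset B ` Z)"
    by (intro inj_on_subset[OF inj_on_image_Pow[OF F(2)]]) auto
  then have "bij_betw (image F) (carrier ?V) (carrier ?W)"
    by (simp add: bij_betw_def image_image image_kcoset[OF F(1)])
  then show ?thesis
    by (rule linear_map.dim_eq_of_bij[OF lin])
qed


section \<open>Invariance of persistent homology\<close>

lemma chains_subtopology_mono:
  "S \<subseteq> T \<Longrightarrow> carrier (chain_space p (subtopology X S)) \<subseteq> carrier (chain_space p (subtopology X T))"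
  by (auto simp: carrier_chain_space intro: singular_simplex_mono)

lemma boundaries_subtopology_mono:
  "S \<subseteq> T \<Longrightarrow> boundaries p (subtopology X S) \<subseteq> boundaries p (subtopology X T)"
  unfolding boundaries_def by (intro image_mono chains_subtopology_mono)

text \<open>The inclusion fixes chains and only enlarges the set of boundaries. This puts the image
  whose dimension is the rank into the form \<open>kquotient\<close>.\<close>

lemma homology_image_inclusion:
  assumes "S \<subseteq> T"
  shows "homology_map p (subtopology X T) id `
         carrier (homology_space p (subtopology X S) :: ('k::field, ('a, 'k) kchain set) module)
       = kcoset (boundaries p (subtopology X T)) ` carrier (cycle_space p (subtopology X S))"
proof -
  let ?B = "boundaries p (subtopology X S) :: ('a, 'k) kchain set"
    and ?B' = "boundaries p (subtopology X T) :: ('a, 'k) kchain set"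
  have "homology_map p (subtopology X T) id (kcoset ?B z) = kcoset ?B' z"
    if z: "z \<in> carrier (cycle_space p (subtopology X S))" for z
  proof -
    have sub: "kcoset ?B z \<subseteq> carrier (chain_space p (subtopology X S))"
      using z boundaries_subset_chains ksubspaceD(2)[OF ksubspace_chains]
      by (fastforce simp: kcoset_def carrier_cycle_space)
    have "homology_map p (subtopology X T) id (kcoset ?B z)
        = (\<Union>x\<in>kcoset ?B z. kcoset ?B' (kchain_map p id x))"
      by (auto simp: homology_map_def a_r_coset_defs cycle_space_def chain_space_def kcoset_def)
    also have "\<dots> = (\<Union>x\<in>kcoset ?B z. kcoset ?B' x)"
      using sub
      by (intro SUP_cong refl arg_cong[of _ _ "kcoset ?B'"]
          kchain_map_id[of _ p "subtopology X S"]) auto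
    \<comment> \<open>Passing to cosets of \<open>?B'\<close> absorbs the elements of
      \<open>?B\<close>, since these bound in the larger set too.\<close>
    also have "\<dots> = kcoset ?B' z"
      by (rule kcoset_UN[where F = "\<lambda>x. x"])
        (simp_all add: klinear_def boundaries_subtopology_mono[OF assms] ksubspace_boundaries)
    finally show ?thesis .
  qed
  then show ?thesis by (simp add: homology_space_eq image_image)
qed

section \<open>Chain maps of homeomorphisms\<close>

lemma kchain_map_image_chains:
  assumes "homeomorphic_maps X Y h k"
  shows "kchain_map p h ` carrier (chain_space p X) = carrier (chain_space p Y)"
proof
  have hk: "continuous_map X Y h" "continuous_map Y X k" "\<And>y. y \<in> topspace Y \<Longrightarrow> h (k y) = y"
    using assms by (auto simp: homeomorphic_maps_def)
  show "kchain_map p h ` carrier (chain_space p X) \<subseteq> carrier (chain_space p Y)"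
    using kchain_map_in_chains hk(1) by blast
  show "carrier (chain_space p Y) \<subseteq> kchain_map p h ` carrier (chain_space p X)"
    using kchain_map_inverse[of _ p Y h k] kchain_map_in_chains[of _ p Y X k] hk
    by (metis image_eqI subsetI)
qed

lemma inj_on_kchain_map:
  assumes "homeomorphic_maps X Y h k"
  shows "inj_on (kchain_map p h) (carrier (chain_space p X))"
  using assms kchain_map_inverse[of _ p X k h]
  by (intro inj_on_inverseI[of _ "kchain_map p k"]) (auto simp: homeomorphic_maps_def)

text \<open>Moving the boundary operator outside leaves the statement on chains one degree
  higher.\<close>

lemma kchain_map_image_boundaries:
  assumes "homeomorphic_maps X Y h k"
  shows "kchain_map p h ` boundaries p X = boundaries p Y"
proof -
  have "kchain_map p h ` boundaries p X
      = kboundary (Suc p) ` kchain_map (Suc p) h ` carrier (chain_space (Suc p) X)"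
    by (simp add: boundaries_def image_image kboundary_kchain_map)
  then show ?thesis
    by (simp add: kchain_map_image_chains[OF assms] boundaries_def)
qed

lemma kchain_map_cycles:
  assumes "z \<in> carrier (cycle_space p X)" "continuous_map X Y h"
  shows "kchain_map p h z \<in> carrier (cycle_space p Y)"
  using assms
  by (auto simp: carrier_cycle_space kchain_map_in_chains kboundary_kchain_map
      klinear_zero[OF klinear_kchain_map])

lemma kchain_map_image_cycles:
  assumes "homeomorphic_maps X Y h k"
  shows "kchain_map p h ` carrier (cycle_space p X) = carrier (cycle_space p Y)"
proof
  have hk: "continuous_map X Y h" "continuous_map Y X k" "\<And>y. y \<in> topspace Y \<Longrightarrow> h (k y) = y"
    using assms by (auto simp: homeomorphic_maps_def)
  show "kchain_map p h ` carrier (cycle_space p X) \<subseteq> carrier (cycle_space p Y)"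
    using kchain_map_cycles hk(1) by blast
  \<comment> \<open>A cycle of \<open>Y\<close> is carried back by \<open>k\<close> to a cycle of
    \<open>X\<close>, and \<open>h\<close> returns it.\<close>
  show "carrier (cycle_space p Y) \<subseteq> kchain_map p h ` carrier (cycle_space p X)"
    using kchain_map_inverse[of _ p Y h k] kchain_map_cycles[of _ p Y X k] hk
    by (smt (verit) carrier_cycle_space image_eqI mem_Collect_eq subsetI)
qed

text \<open>One \<open>h\<close> serves both sets, so its chain map takes the cycles in
  \<open>S\<close> to those in \<open>S'\<close> and the boundaries in \<open>T\<close> to those in
  \<open>T'\<close>; it is injective on the chains of \<open>T\<close>, which contain both.\<close>

lemma dim_homology_image_eq:
  assumes hS: "homeomorphic_maps (subtopology X S) (subtopology Y S') h k"
    and hT: "homeomorphic_maps (subtopology X T) (subtopology Y T') h k"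
    and ST: "S \<subseteq> T" "S' \<subseteq> T'"
  shows "vectorspace.dim class_ring
      ((homology_space p (subtopology X T) :: ('k::field, ('a, 'k) kchain set) module)
        \<lparr>carrier := homology_map p (subtopology X T) id ` carrier (homology_space p (subtopology X S))\<rparr>)
    = vectorspace.dim class_ring
      ((homology_space p (subtopology Y T') :: ('k, ('b, 'k) kchain set) module)
        \<lparr>carrier := homology_map p (subtopology Y T') id ` carrier (homology_space p (subtopology Y S'))\<rparr>)"
proof -
  let ?B = "boundaries p (subtopology X T) :: ('a, 'k) kchain set"
    and ?Z = "carrier (cycle_space p (subtopology X S)) :: ('a, 'k) kchain set"
  have "?Z \<subseteq> carrier (chain_space p (subtopology X T))"
    using chains_subtopology_mono[OF ST(1)] by (auto simp: carrier_cycle_space)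
  then have "vectorspace.dim class_ring (kquotient ?B ?Z)
      = vectorspace.dim class_ring (kquotient (kchain_map p h ` ?B) (kchain_map p h ` ?Z))"
    by (intro dim_kquotient_image[where C = "carrier (chain_space p (subtopology X T))"]
        klinear_kchain_map inj_on_kchain_map[OF hT] ksubspace_boundaries
        boundaries_subset_chains ksubspace_cycles ksubspace_chains)
  then show ?thesis
    by (simp add: homology_image_inclusion ST kchain_map_image_boundaries[OF hT]
        kchain_map_image_cycles[OF hS])
      (simp add: homology_space_eq)
qed

text \<open>As \<open>f\<close> is \<open>g\<close> after \<open>h\<close>, the homeomorphism
  restricts to the sublevel sets at every level. At an infinite parameter both ranks are
  \<open>0\<close>.\<close>

lemma pm_rank_eq:
  assumes h: "homeomorphic_map X Y h" and fg: "\<And>x. x \<in> topspace X \<Longrightarrow> f x = g (h x)" and st: "s \<le> t"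
  shows "pm_rank (\<lambda>t. homology_space p (sublevel X f t) :: ('k::field, ('a, 'k) kchain set) module)
           (\<lambda>s t. homology_map p (sublevel X f t) id) s t
       = pm_rank (\<lambda>t. homology_space p (sublevel Y g t) :: ('k, ('b, 'k) kchain set) module)
           (\<lambda>s t. homology_map p (sublevel Y g t) id) s t"
proof -
  obtain k where hk: "homeomorphic_maps X Y h k"
    using h by (auto simp: homeomorphic_map_maps)
  have im: "h ` topspace X = topspace Y"
    using h by (rule homeomorphic_imp_surjective_map)
  have "homeomorphic_maps (subtopology X {x \<in> topspace X. f x \<le> r})
      (subtopology Y {y \<in> topspace Y. g y \<le> r}) h k" for r
    using fg by (intro homeomorphic_maps_subtopologies[OF hk]) (auto simp flip: im)
  then show ?thesis
    using st unfolding pm_rank_def sublevel_def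
    by (cases s; cases t) (auto intro!: dim_homology_image_eq[where h = h and k = k])
qed

text \<open>A diagram depends only on the ranks at the corners of rectangles, and
  \<open>a < b' < c < d'\<close> puts all four pairs of parameters in the order that
  \<open>pm_rank_eq\<close> demands.\<close>

theorem PH_homeomorphic_map:
  assumes h: "homeomorphic_map X Y h" and fg: "\<And>x. x \<in> topspace X \<Longrightarrow> f x = g (h x)"
  shows "PH TYPE('k::field) p X f = PH TYPE('k) p Y g"
proof -
  have "rectangle_measure (\<lambda>t. homology_space p (sublevel X f t) :: ('k, ('a, 'k) kchain set) module)
          (\<lambda>s t. homology_map p (sublevel X f t) id) a b' c d'
      = rectangle_measure (\<lambda>t. homology_space p (sublevel Y g t) :: ('k, ('b, 'k) kchain set) module)
          (\<lambda>s t. homology_map p (sublevel Y g t) id) a b' c d'"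
    if "a < b'" "b' < c" "c < d'" for a b' c d'
    using that
    by (simp add: rectangle_measure_def
        pm_rank_eq[where h = h and X = X and Y = Y and f = f and g = g, OF h fg])
  then show ?thesis
    unfolding PH_def persistence_diagram_def by (auto intro!: ext cong: conj_cong)
qed


section \<open>Two-point subsets\<close>

lemma F2E:
  assumes "A \<in> topspace (F2 X)"
  obtains x y where "x \<in> topspace X" "y \<in> topspace X" "A = {x, y}"
proof -
  obtain p where "p \<in> topspace (prod_topology X X)" "A = {fst p, snd p}"
    using assms quotient_imp_surjective_map[OF quotient_map_F2[of X]] by blast
  then show ?thesis by (intro that[of "fst p" "snd p"]) auto
qed

text \<open>By the universal property of the quotient it suffices that \<open>image h\<close> after
  the quotient map is continuous; this composite is the quotient map after \<open>h\<close> on both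
  coordinates.\<close>

lemma continuous_map_F2_image:
  assumes "continuous_map X Y h"
  shows "continuous_map (F2 X) (F2 Y) (image h)"
proof -
  have "continuous_map (prod_topology X X) (prod_topology Y Y) (\<lambda>p. (h (fst p), h (snd p)))"
    using assms by (intro continuous_map_pairedI continuous_map_compose[unfolded o_def, OF continuous_map_fst]
        continuous_map_compose[unfolded o_def, OF continuous_map_snd]) 
  then have "continuous_map (prod_topology X X) (F2 Y)
      ((\<lambda>p. {fst p, snd p}) \<circ> (\<lambda>p. (h (fst p), h (snd p))))"
    by (rule continuous_map_compose) (rule quotient_imp_continuous_map[OF quotient_map_F2])
  then have "continuous_map (prod_topology X X) (F2 Y) (image h \<circ> (\<lambda>p. {fst p, snd p}))"
    by (simp add: o_def)
  then show ?thesis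
    by (rule continuous_compose_quotient_map[OF quotient_map_F2])
qed

lemma homeomorphic_map_F2_image:
  assumes "homeomorphic_map X Y h"
  shows "homeomorphic_map (F2 X) (F2 Y) (image h)"
proof -
  obtain k where "homeomorphic_maps X Y h k"
    using assms by (auto simp: homeomorphic_map_maps)
  then have "homeomorphic_maps (F2 X) (F2 Y) (image h) (image k)"
    by (auto simp: homeomorphic_maps_def continuous_map_F2_image elim!: F2E)
  then show ?thesis by (auto simp: homeomorphic_map_maps)
qed

theorem proposition3p5:
  fixes \<gamma> :: "complex \<Rightarrow> real ^ 'n"
    and \<alpha> :: "complex \<Rightarrow> complex"
    and \<omega> :: "real ^ 'n \<Rightarrow> real ^ 'n"
    and i :: nat
  assumes "embedding_map circle euclidean \<gamma>"
    and "homeomorphic_map circle circle \<alpha>"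
    and "\<And>x y. dist (\<omega> x) (\<omega> y) = dist x y"
  shows "PH TYPE('k::field) i (F2 circle) (half_sq_chord (\<omega> \<circ> \<gamma> \<circ> \<alpha>))
       = PH TYPE('k) i (F2 circle) (half_sq_chord \<gamma>)
     \<and> PH TYPE('k) i (F2 circle) (chord (\<omega> \<circ> \<gamma> \<circ> \<alpha>)) = PH TYPE('k) i (F2 circle) (chord \<gamma>)"
proof -
  \<comment> \<open>For \<open>A = {x, y}\<close> both sides are the distance of
    \<open>\<gamma> (\<alpha> x)\<close> and \<open>\<gamma> (\<alpha> y)\<close>, because
    \<open>\<omega>\<close> preserves distances.\<close>
  have chord: "chord (\<omega> \<circ> \<gamma> \<circ> \<alpha>) A = chord \<gamma> (\<alpha> ` A)" if "A \<in> topspace (F2 circle)" for A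
    using that assms(3) by (elim F2E) (simp add: chord_insert flip: dist_norm)
  show ?thesis
    \<comment> \<open>The half squared chord is a function of the chord, so one homeomorphism and
      one identity serve both claims.\<close>
    using homeomorphic_map_F2_image[OF assms(2)]
    by (intro conjI PH_homeomorphic_map) (auto simp: half_sq_chord_def chord)
qed

end
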